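(* Let $A\in\mathbb{R}^{m\times n}$ with $m<n$ have full row rank, let $b\in\mathbb{R}^m$, $b\neq0$, and let $a>0$, $\lambda>0$. Suppose $x^*$ is an optimal solution to $(FP_a^\lambda)$: $\min_{x\in\mathbb{R}^n}\{\|Ax-b\|_2^2+\lambda P_a(x)\}$. Then the following statements hold. (1) If $\lambda>\|b\|_2^2$, then $$\|x^*\|_\infty\le\frac{\|b\|_2^2}{a(\lambda-\|b\|_2^2)}.$$ (2) Let $B$ be the submatrix of $A$ formed by the columns corresponding to the support of $x^*$. Then the columns of $B$ are linearly independent, and hence $\|x^*\|_0\le m$. (3) Let $$\bar\lambda=\|b\|_2^2+\frac{\|A^Tb\|_\infty+\sqrt{\|A^Tb\|_\infty^2+2a\|b\|_2^2\|A^Tb\|_\infty}}{a}.$$ If $\lambda\ge\bar\lambda$, then $x^*=0$.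
   Context: For $a>0$ and $x\in\mathbb{R}^n$, $P_a(x)=\sum_{i=1}^n p_a(x_i)$ with $p_a(t)=\frac{a|t|}{1+a|t|}$. $\|x\|_0$ denotes the number of nonzero entries of $x$; the support of $x$ is $\{i:x_i\neq0\}$. *)

theory Defs
  imports "HOL-Analysis.Analysis"
begin

definition frac_fun :: "real \<Rightarrow> real \<Rightarrow> real"
  where "frac_fun a t = a * \<bar>t\<bar> / (1 + a * \<bar>t\<bar>)"

definition frac_penalty :: "real \<Rightarrow> real ^ 'n \<Rightarrow> real"
  where "frac_penalty a x = (\<Sum>i\<in>UNIV. frac_fun a (x $ i))"

definition supp :: "real ^ 'n \<Rightarrow> 'n set"
  where "supp x = {i. x $ i \<noteq> 0}"

definition l0_norm :: "real ^ 'n \<Rightarrow> nat"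
  where "l0_norm x = card (supp x)"

definition FP_objective ::
    "real ^ 'n ^ 'm \<Rightarrow> real ^ 'm \<Rightarrow> real \<Rightarrow> real \<Rightarrow> real ^ 'n \<Rightarrow> real"
  where "FP_objective A b a lam x = (norm (A *v x - b))\<^sup>2 + lam * frac_penalty a x"

definition FP_optimal ::
    "real ^ 'n ^ 'm \<Rightarrow> real ^ 'm \<Rightarrow> real \<Rightarrow> real \<Rightarrow> real ^ 'n \<Rightarrow> bool"
  where "FP_optimal A b a lam x \<longleftrightarrow> is_arg_min (FP_objective A b a lam) (\<lambda>_. True) x"

(* The columns of A with index in S, i.e. the columns of the submatrix of A selected by S, are
   linearly independent as an indexed family. Since independent is a predicate on sets, injectivity
   is needed to exclude repeated columns; the lemma below gives the coefficient form. *)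
definition columns_independent :: "real ^ 'n ^ 'm \<Rightarrow> 'n set \<Rightarrow> bool"
  where "columns_independent A S \<longleftrightarrow>
    inj_on (\<lambda>j. column j A) S \<and> independent ((\<lambda>j. column j A) ` S)"

lemma columns_independent_iff:
  fixes A :: "real ^ 'n ^ 'm"
  shows "columns_independent A S \<longleftrightarrow>
    (\<forall>c. (\<Sum>j\<in>S. c j *\<^sub>R column j A) = 0 \<longrightarrow> (\<forall>j\<in>S. c j = 0))"
proof
  assume "columns_independent A S"
  then have inj: "inj_on (\<lambda>j. column j A) S"
    and ind: "independent ((\<lambda>j. column j A) ` S)"
    by (auto simp: columns_independent_def)
  show "\<forall>c. (\<Sum>j\<in>S. c j *\<^sub>R column j A) = 0 \<longrightarrow> (\<forall>j\<in>S. c j = 0)"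
  proof (intro allI impI ballI)
    fix c :: "'n \<Rightarrow> real" and j
    assume 0: "(\<Sum>j\<in>S. c j *\<^sub>R column j A) = 0" and j: "j \<in> S"
    define u where "u v = c (the_inv_into S (\<lambda>j. column j A) v)" for v
    have u: "u (column k A) = c k" if "k \<in> S" for k
      using the_inv_into_f_f[OF inj that] by (simp add: u_def)
    have "(\<Sum>v\<in>(\<lambda>j. column j A) ` S. u v *\<^sub>R v) = 0"
      using 0 u by (simp add: sum.reindex[OF inj])
    then have "u (column j A) = 0"
      using ind j by (auto simp: independent_explicit)
    then show "c j = 0" using u j by simp
  qed
next
  assume c: "\<forall>c. (\<Sum>j\<in>S. c j *\<^sub>R column j A) = 0 \<longrightarrow> (\<forall>j\<in>S. c j = 0)"
  have inj: "inj_on (\<lambda>j. column j A) S"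
  proof (rule inj_onI, rule ccontr)
    fix i j assume ij: "i \<in> S" "j \<in> S" "column i A = column j A" "i \<noteq> j"
    define d where "d k = (if k = i then 1 else 0) - (if k = j then 1 else (0::real))" for k
    have "(\<Sum>k\<in>S. d k *\<^sub>R column k A) =
      (\<Sum>k\<in>S. if k = i then column k A else 0) - (\<Sum>k\<in>S. if k = j then column k A else 0)"
      unfolding sum_subtractf[symmetric] by (rule sum.cong) (auto simp: d_def)
    also have "\<dots> = 0" using ij by (simp add: sum.delta)
    finally have "d i = 0" using c ij(1) by blast
    then show False using ij(4) by (simp add: d_def)
  qed
  moreover have "independent ((\<lambda>j. column j A) ` S)"
    unfolding independent_explicit using c by (auto simp: sum.reindex[OF inj])
  ultimately show "columns_independent A S" by (simp add: columns_independent_def)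
qed

definition lambda_bar :: "real ^ 'n ^ 'm \<Rightarrow> real ^ 'm \<Rightarrow> real \<Rightarrow> real"
  where "lambda_bar A b a =
    (let c = infnorm (transpose A *v b) in
      (norm b)\<^sup>2 + (c + sqrt (c\<^sup>2 + 2 * a * (norm b)\<^sup>2 * c)) / a)"

end

(* Part (1) compares the objective at the minimizer with its value at 0.

   For part (2), frac_fun a is strictly concave on each half line. A dependency c among the columns
   indexed by the support gives A c = 0, so for small s > 0 the points x + s c and x - s c have the
   same residual as x, while by strict concavity their penalties add up to less than twice that of x.

   For part (3), comparing with 0 and dropping |Ax|^2 gives sum_i (lam p(x_i) - 2 c |x_i|) <= 0 with
   c = |A^T b|_inf. If x is nonzero, some nonzero t = |x_i| has lam p(t) <= 2 c t, that is,
   lam a <= 2 c (1 + a t). With (lam - |b|^2) (1 + a t) <= lam from part (1) this yields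
   a (lam - |b|^2) <= 2 c, whereas lam >= lambda_bar forces a (lam - |b|^2) > 2 c when c > 0. *)
theory Submission
  imports Defs
begin

lemma frac_fun_0 [simp]: "frac_fun a 0 = 0"
  by (simp add: frac_fun_def)

lemma frac_fun_nonneg: "a \<ge> 0 \<Longrightarrow> frac_fun a t \<ge> 0"
  by (simp add: frac_fun_def)

lemma frac_penalty_0 [simp]: "frac_penalty a 0 = 0"
  by (simp add: frac_penalty_def)

lemma frac_fun_le_penalty: "a \<ge> 0 \<Longrightarrow> frac_fun a (x $ i) \<le> frac_penalty a x"
  unfolding frac_penalty_def by (rule member_le_sum) (auto simp: frac_fun_nonneg)

section \<open>Strict concavity of the penalty away from zero\<close>

lemma inverse_strict_midpoint:
  fixes u e :: real
  assumes "\<bar>e\<bar> < u" "e \<noteq> 0"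
  shows "2 / u < 1 / (u + e) + 1 / (u - e)"
proof -
  have pos: "u + e > 0" "u - e > 0" "u > 0" using assms by auto
  have "1 / (u + e) + 1 / (u - e) - 2 / u = 2 * e\<^sup>2 / (u * (u + e) * (u - e))"
    using pos by (simp add: divide_simps power2_eq_square) (simp add: algebra_simps)
  also have "\<dots> > 0" using pos assms(2) by simp
  finally show ?thesis by simp
qed

text \<open>Since \<open>frac_fun a s\<close> is 1 - 1 / (1 + a |s|), this is strict convexity of 1
  / u at u = 1 + a |t|. The bound on \<open>d\<close> keeps t + d and t - d on the same side of 0 as
  t, away from the kink of |.|.\<close>

lemma frac_fun_strict_midpoint:
  assumes "a > 0" "\<bar>d\<bar> < \<bar>t\<bar>" "d \<noteq> 0"
  shows "frac_fun a (t + d) + frac_fun a (t - d) < 2 * frac_fun a t"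
proof -
  have frac: "frac_fun a s = 1 - 1 / (1 + a * \<bar>s\<bar>)" for s
  proof -
    have "1 + a * \<bar>s\<bar> > 0" using assms(1) by (simp add: add_pos_nonneg)
    then show ?thesis by (simp add: frac_fun_def field_simps)
  qed
  \<comment> \<open>\<open>e\<close> is the change of 1 + a |t| when t moves by \<open>d\<close>;
    its sign is reversed for negative t.\<close>
  define e where "e = a * (if t > 0 then d else - d)"
  have "\<bar>t + d\<bar> = \<bar>t\<bar> + (if t > 0 then d else - d)" "\<bar>t - d\<bar> = \<bar>t\<bar> - (if t > 0 then d else - d)"
    using assms(2) by auto
  then have eq: "1 + a * \<bar>t + d\<bar> = (1 + a * \<bar>t\<bar>) + e" "1 + a * \<bar>t - d\<bar> = (1 + a * \<bar>t\<bar>) - e"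
    by (simp_all only: e_def) (simp_all add: algebra_simps)
  have "\<bar>e\<bar> = a * \<bar>d\<bar>" using assms(1) by (simp add: e_def abs_mult)
  also have "\<dots> < 1 + a * \<bar>t\<bar>" using assms mult_strict_left_mono[OF assms(2,1)] by linarith
  finally have "\<bar>e\<bar> < 1 + a * \<bar>t\<bar>" .
  moreover have "e \<noteq> 0" using assms by (simp add: e_def)
  ultimately have "2 / (1 + a * \<bar>t\<bar>) < 1 / (1 + a * \<bar>t\<bar> + e) + 1 / (1 + a * \<bar>t\<bar> - e)"
    by (rule inverse_strict_midpoint)
  then show ?thesis unfolding frac eq by simp
qed

text \<open>Coordinates with \<open>d $ i = 0\<close> give equality and all others a strict
  inequality; \<open>d \<noteq> 0\<close> provides one of the latter.\<close>

lemma frac_penalty_strict_midpoint: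
  fixes x d :: "real ^ 'n"
  assumes "a > 0" "d \<noteq> 0" "\<And>i. d $ i \<noteq> 0 \<Longrightarrow> \<bar>d $ i\<bar> < \<bar>x $ i\<bar>"
  shows "frac_penalty a (x + d) + frac_penalty a (x - d) < 2 * frac_penalty a x"
proof -
  have le: "frac_fun a (x $ i + d $ i) + frac_fun a (x $ i - d $ i) \<le> 2 * frac_fun a (x $ i)" for i
    using frac_fun_strict_midpoint[OF assms(1,3), of i] by (cases "d $ i = 0") auto
  obtain k where "d $ k \<noteq> 0" using assms(2) by (auto simp: vec_eq_iff)
  then have lt: "frac_fun a (x $ k + d $ k) + frac_fun a (x $ k - d $ k) < 2 * frac_fun a (x $ k)"
    using frac_fun_strict_midpoint[OF assms(1,3)] by blast
  have "(\<Sum>i\<in>UNIV. frac_fun a (x $ i + d $ i) + frac_fun a (x $ i - d $ i))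
      < (\<Sum>i\<in>UNIV. 2 * frac_fun a (x $ i))"
    by (rule sum_strict_mono_ex1) (use le lt in auto)
  then show ?thesis
    by (simp add: frac_penalty_def sum.distrib sum_distrib_left)
qed

text \<open>As s tends to 0 from the right, each of the finitely many conditions holds eventually,
  hence all hold together for some s > 0.\<close>

lemma exists_small_scaling:
  fixes c x :: "real ^ 'n"
  assumes "\<And>i. c $ i \<noteq> 0 \<Longrightarrow> x $ i \<noteq> 0"
  obtains s :: real where "s > 0" "\<And>i. c $ i \<noteq> 0 \<Longrightarrow> \<bar>s * c $ i\<bar> < \<bar>x $ i\<bar>"
proof -
  have "\<forall>\<^sub>F s in at_right (0::real). \<forall>i. c $ i \<noteq> 0 \<longrightarrow> \<bar>s * c $ i\<bar> < \<bar>x $ i\<bar>"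
  proof (rule eventually_all_finite)
    fix i
    have "((\<lambda>s. \<bar>s * c $ i\<bar>) \<longlongrightarrow> \<bar>0 * c $ i\<bar>) (at_right 0)" by (intro tendsto_intros)
    then show "\<forall>\<^sub>F s in at_right (0::real). c $ i \<noteq> 0 \<longrightarrow> \<bar>s * c $ i\<bar> < \<bar>x $ i\<bar>"
      using order_tendstoD(2)[of "\<lambda>s. \<bar>s * c $ i\<bar>" 0 "at_right 0" "\<bar>x $ i\<bar>"] assms[of i]
      by (cases "c $ i = 0") auto
  qed
  moreover have "\<forall>\<^sub>F s in at_right (0::real). s > 0" by (rule eventually_at_right_less)
  ultimately have "\<forall>\<^sub>F s in at_right (0::real). s > 0 \<and> (\<forall>i. c $ i \<noteq> 0 \<longrightarrow> \<bar>s * c $ i\<bar> < \<bar>x $ i\<bar>)"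
    by eventually_elim auto
  then show ?thesis using that eventually_happens trivial_limit_at_right_real by blast
qed

section \<open>Consequences of optimality\<close>

lemma FP_optimal_le: "FP_optimal A b a lam x \<Longrightarrow> FP_objective A b a lam x \<le> FP_objective A b a lam y"
  by (auto simp: FP_optimal_def is_arg_min_linorder)

text \<open>The form without division serves both the bound on \<open>infnorm x\<close> and the last
  estimate of \<open>FP_optimal_zero\<close>.\<close>

lemma FP_optimal_component_bound:
  assumes "FP_optimal A b a lam x" "a > 0" "lam > 0"
  shows "a * \<bar>x $ i\<bar> * (lam - (norm b)\<^sup>2) \<le> (norm b)\<^sup>2"
proof -
  have "lam * frac_fun a (x $ i) \<le> lam * frac_penalty a x"
    using assms(2,3) by (intro mult_left_mono frac_fun_le_penalty) auto
  also have "\<dots> \<le> (norm b)\<^sup>2"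
    \<comment> \<open>The objective at 0 is |b|^2, and the squared residual at \<open>x\<close> is
      dropped.\<close>
    using FP_optimal_le[OF assms(1), of 0] by (simp add: FP_objective_def) (smt (verit) zero_le_power2)
  finally have "lam * (a * \<bar>x $ i\<bar>) / (1 + a * \<bar>x $ i\<bar>) \<le> (norm b)\<^sup>2" by (simp add: frac_fun_def)
  moreover have "1 + a * \<bar>x $ i\<bar> > 0" using assms(2) by (simp add: add_pos_nonneg)
  ultimately show ?thesis by (simp add: pos_divide_le_eq algebra_simps)
qed

lemma FP_optimal_columns_independent:
  fixes A :: "real ^ 'n ^ 'm"
  assumes opt: "FP_optimal A b a lam x" and "a > 0" "lam > 0"
  shows "columns_independent A (supp x)"
  unfolding columns_independent_iff
proof (intro allI impI, rule ccontr)
  fix c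
  assume c: "(\<Sum>j\<in>supp x. c j *\<^sub>R column j A) = 0" and "\<not> (\<forall>j\<in>supp x. c j = 0)"
  \<comment> \<open>Extending the coefficients by zero off the support turns the dependency into a
    kernel vector of \<open>A\<close>.\<close>
  define v :: "real ^ 'n" where "v = (\<chi> j. if j \<in> supp x then c j else 0)"
  have "v \<noteq> 0" using \<open>\<not> _\<close> by (auto simp: v_def vec_eq_iff)
  have "A *v v = (\<Sum>j\<in>UNIV. if j \<in> supp x then c j *\<^sub>R column j A else 0)"
    unfolding matrix_mult_sum
    by (rule sum.cong) (auto simp: v_def scalar_mult_eq_scaleR)
  also have "\<dots> = 0" using c by (simp add: sum.If_cases)
  finally have Av: "A *v v = 0" .
  obtain s where s: "s > 0" "\<And>i. v $ i \<noteq> 0 \<Longrightarrow> \<bar>s * v $ i\<bar> < \<bar>x $ i\<bar>"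
    by (rule exists_small_scaling[of v x]) (auto simp: v_def supp_def split: if_splits)
  define d where "d = s *\<^sub>R v"
  have Ad: "A *v d = 0" by (simp add: d_def matrix_vector_mult_scaleR Av)
  \<comment> \<open>The residuals at x + d, x - d and x agree, so optimality compares the penalties
    alone.\<close>
  have "lam * frac_penalty a x \<le> lam * frac_penalty a (x + d)"
       "lam * frac_penalty a x \<le> lam * frac_penalty a (x - d)"
    using FP_optimal_le[OF opt, of "x + d"] FP_optimal_le[OF opt, of "x - d"]
    by (simp_all add: FP_objective_def matrix_vector_right_distrib matrix_vector_mult_diff_distrib Ad)
  then have "2 * frac_penalty a x \<le> frac_penalty a (x + d) + frac_penalty a (x - d)"
    using assms(3) by simp
  moreover have "frac_penalty a (x + d) + frac_penalty a (x - d) < 2 * frac_penalty a x"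
    using s \<open>v \<noteq> 0\<close> by (intro frac_penalty_strict_midpoint assms(2)) (auto simp: d_def)
  ultimately show False by simp
qed

lemma card_le_of_columns_independent:
  fixes A :: "real ^ 'n ^ 'm"
  assumes "columns_independent A S"
  shows "card S \<le> CARD('m)"
  using assms independent_bound[of "(\<lambda>j. column j A) ` S"]
  by (simp add: columns_independent_def card_image)

text \<open>Hoelder's inequality for the dual pair of the 1-norm and the maximum norm.\<close>

lemma inner_le_infnorm_sum_abs:
  fixes x v :: "real ^ 'n"
  shows "x \<bullet> v \<le> infnorm v * (\<Sum>i\<in>UNIV. \<bar>x $ i\<bar>)"
  unfolding inner_vec_def sum_distrib_left
proof (rule sum_mono)
  fix i
  have "x $ i \<bullet> v $ i \<le> \<bar>v $ i\<bar> * \<bar>x $ i\<bar>" by (simp add: abs_mult[symmetric] mult.commute)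
  also have "\<dots> \<le> infnorm v * \<bar>x $ i\<bar>" by (intro mult_right_mono component_le_infnorm_cart) auto
  finally show "x $ i \<bullet> v $ i \<le> infnorm v * \<bar>x $ i\<bar>" .
qed

lemma FP_optimal_sum_le:
  assumes "FP_optimal A b a lam x"
  shows "(\<Sum>i\<in>UNIV. lam * frac_fun a (x $ i) - 2 * infnorm (transpose A *v b) * \<bar>x $ i\<bar>) \<le> 0"
proof -
  have "(norm (A *v x - b))\<^sup>2 = (norm (A *v x))\<^sup>2 - 2 * ((A *v x) \<bullet> b) + (norm b)\<^sup>2"
    by (simp add: power2_norm_eq_inner inner_diff inner_commute)
  moreover have "(norm (A *v x - b))\<^sup>2 + lam * frac_penalty a x \<le> (norm b)\<^sup>2"
    using FP_optimal_le[OF assms, of 0] by (simp add: FP_objective_def)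
  moreover have "(A *v x) \<bullet> b = x \<bullet> (transpose A *v b)"
    by (metis dot_lmul_matrix inner_commute vector_transpose_matrix transpose_transpose)
  ultimately have "lam * frac_penalty a x \<le> 2 * (x \<bullet> (transpose A *v b))"
    by (smt (verit) zero_le_power2)
  also have "\<dots> \<le> 2 * (infnorm (transpose A *v b) * (\<Sum>i\<in>UNIV. \<bar>x $ i\<bar>))"
    using inner_le_infnorm_sum_abs by simp
  finally show ?thesis
    by (simp add: frac_penalty_def sum_subtractf sum_distrib_left mult.assoc)
qed

lemma FP_optimal_zero:
  fixes A :: "real ^ 'n ^ 'm"
  assumes opt: "FP_optimal A b a lam x" and "a > 0" "lam > 0" "b \<noteq> 0"
    and lam: "lam \<ge> lambda_bar A b a"
  shows "x = 0"
proof (rule ccontr)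
  assume "x \<noteq> 0"
  define c where "c = infnorm (transpose A *v b)"
  define B where "B = (norm b)\<^sup>2"
  have "c \<ge> 0" "B > 0" using \<open>b \<noteq> 0\<close> by (simp_all add: c_def B_def infnorm_pos_le)
  \<comment> \<open>Otherwise the sum in \<open>FP_optimal_sum_le\<close> would be positive, as zero
    coordinates contribute 0 to it.\<close>
  have "\<exists>i. x $ i \<noteq> 0 \<and> lam * frac_fun a (x $ i) \<le> 2 * c * \<bar>x $ i\<bar>"
  proof (rule ccontr)
    assume "\<not> ?thesis"
    then have pos: "0 < lam * frac_fun a (x $ i) - 2 * c * \<bar>x $ i\<bar>" if "x $ i \<noteq> 0" for i
      using that by (auto simp: not_le)
    then have nonneg: "0 \<le> lam * frac_fun a (x $ i) - 2 * c * \<bar>x $ i\<bar>" for i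
      by (cases "x $ i = 0") (auto intro: less_imp_le)
    obtain k where "x $ k \<noteq> 0" using \<open>x \<noteq> 0\<close> by (auto simp: vec_eq_iff)
    then have "0 < (\<Sum>i\<in>UNIV. lam * frac_fun a (x $ i) - 2 * c * \<bar>x $ i\<bar>)"
      using pos nonneg by (intro sum_pos2[where i = k]) auto
    then show False using FP_optimal_sum_le[OF opt] by (simp add: c_def)
  qed
  then obtain i where "x $ i \<noteq> 0" and le: "lam * frac_fun a (x $ i) \<le> 2 * c * \<bar>x $ i\<bar>" by blast
  define t where "t = \<bar>x $ i\<bar>"
  have "t > 0" using \<open>x $ i \<noteq> 0\<close> by (simp add: t_def)
  have u: "1 + a * t > 0" using \<open>t > 0\<close> assms(2) by (simp add: add_pos_nonneg)
  have "(lam * a) * t \<le> (2 * c * (1 + a * t)) * t"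
    using le u by (simp add: frac_fun_def t_def[symmetric] pos_divide_le_eq algebra_simps)
  then have la: "lam * a \<le> 2 * c * (1 + a * t)" using \<open>t > 0\<close> by simp
  have "c > 0"
    using la \<open>c \<ge> 0\<close> assms(2,3) by (cases "c = 0") (auto simp: mult_le_0_iff)
  \<comment> \<open>The root exceeds \<open>c\<close> strictly, so 2 c < a (lam - B) is strict even
    when \<open>lam\<close> equals \<open>lambda_bar A b a\<close>.\<close>
  have "c\<^sup>2 < c\<^sup>2 + 2 * a * B * c" using \<open>c > 0\<close> \<open>B > 0\<close> assms(2) by simp
  then have "c < sqrt (c\<^sup>2 + 2 * a * B * c)" using \<open>c > 0\<close> by (simp add: real_less_rsqrt)
  moreover have "c + sqrt (c\<^sup>2 + 2 * a * B * c) \<le> a * (lam - B)"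
  proof -
    have "(c + sqrt (c\<^sup>2 + 2 * a * B * c)) / a \<le> lam - B"
      using lam by (simp add: lambda_bar_def Let_def c_def B_def)
    then show ?thesis using assms(2) by (simp add: pos_divide_le_eq mult.commute)
  qed
  ultimately have gt: "2 * c < a * (lam - B)" by simp
  then have "lam - B > 0" using \<open>c > 0\<close> assms(2) by (smt (verit) zero_less_mult_pos)
  have "(lam * a) * (lam - B) \<le> 2 * c * (1 + a * t) * (lam - B)"
    using la \<open>lam - B > 0\<close> by (intro mult_right_mono) auto
  also have "\<dots> = 2 * c * (lam - B + a * t * (lam - B))" by (simp add: algebra_simps)
  \<comment> \<open>The component bound a t (lam - B) <= B makes the bracket at most
    \<open>lam\<close>; cancelling \<open>lam\<close> then contradicts \<open>gt\<close>.\<close>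
  also have "\<dots> \<le> 2 * c * lam"
    using FP_optimal_component_bound[OF opt assms(2,3), of i] \<open>c > 0\<close> by (simp add: t_def B_def)
  finally have "lam * (a * (lam - B)) \<le> lam * (2 * c)" by (simp add: mult_ac)
  then show False using gt assms(3) by simp
qed

theorem lemma5:
  fixes A :: "real ^ 'n ^ 'm" and b :: "real ^ 'm" and a lam :: real and x :: "real ^ 'n"
  assumes "CARD('m) < CARD('n)"
    and "rank A = CARD('m)"
    and "b \<noteq> 0"
    and "a > 0"
    and "lam > 0"
    and "FP_optimal A b a lam x"
  shows "(lam > (norm b)\<^sup>2 \<longrightarrow> infnorm x \<le> (norm b)\<^sup>2 / (a * (lam - (norm b)\<^sup>2)))
    \<and> (columns_independent A (supp x) \<and> l0_norm x \<le> CARD('m))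
    \<and> (lam \<ge> lambda_bar A b a \<longrightarrow> x = 0)"
proof (intro conjI impI)
  assume "lam > (norm b)\<^sup>2"
  then have "a * (lam - (norm b)\<^sup>2) > 0" using assms(4) by simp
  then have "\<bar>x $ i\<bar> \<le> (norm b)\<^sup>2 / (a * (lam - (norm b)\<^sup>2))" for i
    using FP_optimal_component_bound[OF assms(6,4,5), of i] by (simp add: pos_le_divide_eq mult_ac)
  then show "infnorm x \<le> (norm b)\<^sup>2 / (a * (lam - (norm b)\<^sup>2))"
    unfolding infnorm_cart by (intro cSup_least) auto
next
  show ind: "columns_independent A (supp x)"
    by (rule FP_optimal_columns_independent[OF assms(6,4,5)])
  show "l0_norm x \<le> CARD('m)"
    unfolding l0_norm_def by (rule card_le_of_columns_independent[OF ind])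
next
  assume "lam \<ge> lambda_bar A b a"
  then show "x = 0" by (rule FP_optimal_zero[OF assms(6,4,5,3)])
qed

end
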